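(* Let $L>0$, $T>0$, $\varepsilon_0>0$, $\mathcal{M}>0$, $d\ge c>0$ and $k_0,k_L\in\mathbb{R}$. Assume that the source terms $G_\pm$ satisfy $$|G_\pm(\delta_+,\delta_-)|\le \mathcal{M}\,(|\delta_+|+|\delta_-|).$$ Assume that the closed loop system $$\begin{pmatrix}\delta_+\\ \delta_-\end{pmatrix}_t+\begin{pmatrix}\lambda_+(\delta_+,\delta_-)&0\\0&\lambda_-(\delta_+,\delta_-)\end{pmatrix}\begin{pmatrix}\delta_+\\ \delta_-\end{pmatrix}_x=\begin{pmatrix}G_+(\delta_+,\delta_-)\\ G_-(\delta_+,\delta_-)\end{pmatrix},\qquad \delta_+(t,0)=k_0\,\delta_-(t,0),\quad \delta_-(t,L)=k_L\,\delta_+(t,L)$$ has a classical solution on $[0,T]$ (for $x\in[0,L]$) such that for all $t\in[0,T]$ and $x\in[0,L]$, along the solution, $$|\partial_x(\lambda_\pm(\delta_+,\delta_-))|\le\varepsilon_0,\qquad -d\le\lambda_-(\delta_+,\delta_-)\le -c,\qquad c\le\lambda_+(\delta_+,\delta_-)\le d .$$ Assume moreover that $$(2\varepsilon_0+6\mathcal{M})\,L<c$$ and that the feedback gains $|k_0|$ and $|k_L|$ are sufficiently small (for example, that the inequality $(\ast)$ below holds, with $\psi,\upsilon$ chosen as described there). Then the closed loop system decays exponentially fast on $[0,T]$. If $\psi>0$ and $\upsilon\in(\tanh^2(\psi L),1]$ are chosen such that $$3\mathcal{M}L+\varepsilon_0L\le\frac c2\,\psi L\left(\frac1{\sqrt\upsilon}-\sqrt\upsilon\right),$$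 and the gains are sufficiently small, for example such that for $i\in\{0,L\}$ $$(\ast)\qquad k_i^2\le\frac cd\;\frac{\sqrt\upsilon\left(1+\frac1{\cosh(\psi L)}\right)-\tanh(\psi L)}{\sqrt\upsilon\left(1+\frac1{\cosh(\psi L)}\right)+\tanh(\psi L)},$$ then the Lyapunov function $$\mathcal{E}(t)=\frac12\int_0^L h_+\!\left(x-\tfrac L2\right)|\delta_+(t,x)|^2+h_-\!\left(x-\tfrac L2\right)|\delta_-(t,x)|^2\,dx$$ decays exponentially with the rate $c\,\psi\sqrt\upsilon$, i.e. $\mathcal{E}(t)\le e^{-c\psi\sqrt\upsilon\,t}\,\mathcal{E}(0)$ for all $t\in[0,T]$.
   Context: The unknowns $\delta_\pm$ are real-valued functions of $(t,x)\in[0,T]\times[0,L]$; a classical solution is a $C^1$ solution. The functions $\lambda_\pm$ (continuously differentiable) and $G_\pm$ (continuous) are given real-valued functions of $(\delta_+,\delta_-)$. For $\psi>0$ and $\upsilon>\tanh^2(\psi L)$ the hyperbolic weight functions are $h_\pm(x)=\sqrt\upsilon\cosh(\psi x)\mp\sinh(\psi x)$ for $x\in[-L,L]$; they take only positive values there. "Gains sufficiently small" means $|k_0|,|k_L|\le\kappa$ for some $\kappa>0$ depending only on $c,d,\varepsilon_0,\mathcal{M},L$ (and on the choice of $\psi,\upsilon$ where these are fixed). "Decays exponentially fast on $[0,T]$" means that for suitable $\psi>0$ and $\upsilon\in(\tanh^2(\psi L),1]$ depending only on $c,\varepsilon_0,\mathcal{M},L$ there is a $\mu>0$ depending only on $c,\psi,\upsilon$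 with $\mathcal{E}(t)\le e^{-\mu t}\mathcal{E}(0)$ for all $t\in[0,T]$. *)

theory Defs
  imports "HOL-Analysis.Analysis"
begin

(* For S the closed rectangle {0..T} \<times> {0..L}, derivatives are taken within S,
   hence one-sided at the boundary; they are unique when T, L > 0. *)
definition C1_on :: "('a::real_normed_vector \<Rightarrow> 'b::real_normed_vector) \<Rightarrow> 'a set \<Rightarrow> bool" where
  "C1_on f S \<longleftrightarrow> (\<exists>f' :: 'a \<Rightarrow> 'a \<Rightarrow>\<^sub>L 'b.
     (\<forall>z\<in>S. (f has_derivative blinfun_apply (f' z)) (at z within S)) \<and> continuous_on S f')"

definition partial_t :: "real \<Rightarrow> (real \<times> real \<Rightarrow> real) \<Rightarrow> real \<Rightarrow> real \<Rightarrow> real" where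
  "partial_t T f t x = vector_derivative (\<lambda>s. f (s, x)) (at t within {0..T})"

definition partial_x :: "real \<Rightarrow> (real \<times> real \<Rightarrow> real) \<Rightarrow> real \<Rightarrow> real \<Rightarrow> real" where
  "partial_x L f t x = vector_derivative (\<lambda>y. f (t, y)) (at x within {0..L})"

definition classical_solution ::
  "real \<Rightarrow> real \<Rightarrow> real \<Rightarrow> real \<Rightarrow> (real \<times> real \<Rightarrow> real) \<Rightarrow> (real \<times> real \<Rightarrow> real) \<Rightarrow>
   (real \<times> real \<Rightarrow> real) \<Rightarrow> (real \<times> real \<Rightarrow> real) \<Rightarrow>
   (real \<times> real \<Rightarrow> real) \<Rightarrow> (real \<times> real \<Rightarrow> real) \<Rightarrow> bool" where
  "classical_solution T L k\<^sub>0 k\<^sub>L lamp lamm Gp Gm \<delta>p \<delta>m \<longleftrightarrow>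
     C1_on \<delta>p ({0..T} \<times> {0..L}) \<and> C1_on \<delta>m ({0..T} \<times> {0..L}) \<and>
     (\<forall>t\<in>{0..T}. \<forall>x\<in>{0..L}.
        partial_t T \<delta>p t x + lamp (\<delta>p (t, x), \<delta>m (t, x)) * partial_x L \<delta>p t x
          = Gp (\<delta>p (t, x), \<delta>m (t, x)) \<and>
        partial_t T \<delta>m t x + lamm (\<delta>p (t, x), \<delta>m (t, x)) * partial_x L \<delta>m t x
          = Gm (\<delta>p (t, x), \<delta>m (t, x))) \<and>
     (\<forall>t\<in>{0..T}. \<delta>p (t, 0) = k\<^sub>0 * \<delta>m (t, 0) \<and> \<delta>m (t, L) = k\<^sub>L * \<delta>p (t, L))"

definition source_bound :: "real \<Rightarrow> (real \<times> real \<Rightarrow> real) \<Rightarrow> bool" where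
  "source_bound M G \<longleftrightarrow> (\<forall>a b. \<bar>G (a, b)\<bar> \<le> M * (\<bar>a\<bar> + \<bar>b\<bar>))"

definition speed_bounds ::
  "real \<Rightarrow> real \<Rightarrow> real \<Rightarrow> real \<Rightarrow> real \<Rightarrow> (real \<times> real \<Rightarrow> real) \<Rightarrow> (real \<times> real \<Rightarrow> real) \<Rightarrow>
   (real \<times> real \<Rightarrow> real) \<Rightarrow> (real \<times> real \<Rightarrow> real) \<Rightarrow> bool" where
  "speed_bounds T L \<epsilon>\<^sub>0 c d lamp lamm \<delta>p \<delta>m \<longleftrightarrow>
     (\<forall>t\<in>{0..T}. \<forall>x\<in>{0..L}.
        \<bar>partial_x L (\<lambda>z. lamp (\<delta>p z, \<delta>m z)) t x\<bar> \<le> \<epsilon>\<^sub>0 \<and>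
        \<bar>partial_x L (\<lambda>z. lamm (\<delta>p z, \<delta>m z)) t x\<bar> \<le> \<epsilon>\<^sub>0 \<and>
        - d \<le> lamm (\<delta>p (t, x), \<delta>m (t, x)) \<and> lamm (\<delta>p (t, x), \<delta>m (t, x)) \<le> - c \<and>
        c \<le> lamp (\<delta>p (t, x), \<delta>m (t, x)) \<and> lamp (\<delta>p (t, x), \<delta>m (t, x)) \<le> d)"

definition h_plus :: "real \<Rightarrow> real \<Rightarrow> real \<Rightarrow> real" where
  "h_plus \<psi> \<upsilon> x = sqrt \<upsilon> * cosh (\<psi> * x) - sinh (\<psi> * x)"

definition h_minus :: "real \<Rightarrow> real \<Rightarrow> real \<Rightarrow> real" where
  "h_minus \<psi> \<upsilon> x = sqrt \<upsilon> * cosh (\<psi> * x) + sinh (\<psi> * x)"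

definition lyapunov ::
  "real \<Rightarrow> real \<Rightarrow> real \<Rightarrow> (real \<times> real \<Rightarrow> real) \<Rightarrow> (real \<times> real \<Rightarrow> real) \<Rightarrow> real \<Rightarrow> real" where
  "lyapunov L \<psi> \<upsilon> \<delta>p \<delta>m t =
     1 / 2 * integral {0..L} (\<lambda>x. h_plus \<psi> \<upsilon> (x - L / 2) * \<bar>\<delta>p (t, x)\<bar>\<^sup>2
                                 + h_minus \<psi> \<upsilon> (x - L / 2) * \<bar>\<delta>m (t, x)\<bar>\<^sup>2)"

definition weight_choice :: "real \<Rightarrow> real \<Rightarrow> real \<Rightarrow> real \<Rightarrow> real \<Rightarrow> real \<Rightarrow> bool" where
  "weight_choice L \<epsilon>\<^sub>0 M c \<psi> \<upsilon> \<longleftrightarrow>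
     3 * M * L + \<epsilon>\<^sub>0 * L \<le> c / 2 * (\<psi> * L) * (1 / sqrt \<upsilon> - sqrt \<upsilon>)"

definition gain_bound :: "real \<Rightarrow> real \<Rightarrow> real \<Rightarrow> real \<Rightarrow> real \<Rightarrow> real \<Rightarrow> bool" where
  "gain_bound L c d \<psi> \<upsilon> k \<longleftrightarrow>
     k\<^sup>2 \<le> c / d * ((sqrt \<upsilon> * (1 + 1 / cosh (\<psi> * L)) - tanh (\<psi> * L))
                  / (sqrt \<upsilon> * (1 + 1 / cosh (\<psi> * L)) + tanh (\<psi> * L)))"

end

theory Submission
  imports Defs
begin

text \<open>
  The proof is a differential inequality for the Lyapunov function \<open>\<E>\<close>, namely
  \<open>\<E>' \<le> - c \<psi> \<surd>\<upsilon> \<E>\<close>, from which the exponential bound follows by monotonicity of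
  \<open>exp (c \<psi> \<surd>\<upsilon> t) \<E>(t)\<close>.

  Differentiating \<open>\<E>\<close> under the integral sign (\<open>lyapunov_has_derivative\<close>) and inserting the equations
  gives source terms and transport terms; the latter are integrated by parts
  (\<open>lyapunov_derivative_le\<close>). Three effects then have to be compared. The weight \<open>h\<^sub>+\<close> decreases in
  the direction in which \<open>\<delta>\<^sub>+\<close> travels and \<open>h\<^sub>-\<close> decreases in the direction in which \<open>\<delta>\<^sub>-\<close>
  travels, so transport at speed at least \<open>c\<close> dissipates: the derivatives of the weights are
  \<open>\<mp> \<psi> \<surd>\<upsilon> h\<^sub>\<plusminus>\<close>, which gives the rate \<open>c \<psi> \<surd>\<upsilon>\<close>, plus a surplus \<open>\<mp> \<psi> (1 - \<upsilon>) cosh\<close>. The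
  sources and the space variation of the speeds can feed energy in, but the condition relating
  \<open>M\<close>, \<open>\<epsilon>\<^sub>0\<close>, \<open>\<psi>\<close> and \<open>\<upsilon>\<close> is precisely that the surplus dominates them pointwise
  (\<open>pointwise_dissipation\<close>). Finally the ends of the interval do not feed energy in, because the
  bound on the gains compares the weight of the wave leaving the interval with that of its reflection
  (\<open>gain_bound_iff\<close>, \<open>boundary_dissipation\<close>).

  It remains to see that suitable weights exist as soon as \<open>(2 \<epsilon>\<^sub>0 + 6 M) L < c\<close>
  (\<open>weight_choice_exists\<close>), and that the gain bound has a positive right-hand side, so that it holds
  for all sufficiently small gains (\<open>small_gains_satisfy_gain_bound\<close>).
\<close>

section \<open>Partial derivatives of continuously differentiable functions\<close>

lemma C1_on_partial_t:
  assumes "C1_on f ({0..T} \<times> {0..L})" and "T > 0" and "t \<in> {0..T}" "x \<in> {0..L}"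
  shows "((\<lambda>s. f (s, x)) has_real_derivative partial_t T f t x) (at t within {0..T})"
    and "continuous_on ({0..T} \<times> {0..L}) (\<lambda>z. partial_t T f (fst z) (snd z))"
proof -
  obtain f' where f': "\<And>z. z \<in> {0..T} \<times> {0..L} \<Longrightarrow>
        (f has_derivative blinfun_apply (f' z)) (at z within {0..T} \<times> {0..L})"
    and cont: "continuous_on ({0..T} \<times> {0..L}) f'"
    using assms(1) unfolding C1_on_def by blast
  have slice: "((\<lambda>s. f (s, x)) has_vector_derivative f' (t, x) (1, 0)) (at t within {0..T})"
    if "t \<in> {0..T}" "x \<in> {0..L}" for t x
  proof -
    have "((\<lambda>s. f (s, x)) has_derivative (\<lambda>h. f' (t, x) (h, 0))) (at t within {0..T})"
      using that by (intro has_derivative_in_compose2[OF f']) (auto intro!: derivative_eq_intros)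
    moreover have "(h, 0::real) = h *\<^sub>R (1, 0)" for h :: real
      by simp
    then have "(\<lambda>h. f' (t, x) (h, 0)) = (\<lambda>h. h *\<^sub>R f' (t, x) (1, 0))"
      by (metis blinfun.scaleR_right)
    ultimately show ?thesis
      unfolding has_vector_derivative_def by (simp only:)
  qed
  have eq: "partial_t T f t x = f' (t, x) (1, 0)" if "t \<in> {0..T}" "x \<in> {0..L}" for t x
    unfolding partial_t_def
    using vector_derivative_within_closed_interval[OF _ _ slice] that \<open>T > 0\<close> by simp
  show "((\<lambda>s. f (s, x)) has_real_derivative partial_t T f t x) (at t within {0..T})"
    using slice eq assms by (simp add: has_real_derivative_iff_has_vector_derivative)
  have "continuous_on ({0..T} \<times> {0..L}) (\<lambda>z. f' z (1, 0))"
    by (intro continuous_intros cont)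
  then show "continuous_on ({0..T} \<times> {0..L}) (\<lambda>z. partial_t T f (fst z) (snd z))"
    by (rule continuous_on_eq) (auto simp: eq)
qed

text \<open>
  Differentiability is the natural hypothesis here because the lemma is applied to the composed speeds
  \<open>\<lambda>\<^sub>\<plusminus>(\<delta>\<^sub>+, \<delta>\<^sub>-)\<close> too: the flux below only has to be differentiable in \<open>x\<close>, since the
  fundamental theorem of calculus for the gauge integral already makes its derivative integrable.
\<close>

lemma has_partial_x:
  assumes "f differentiable at (t, x) within {0..T} \<times> {0..L}"
    and "L > 0" and "t \<in> {0..T}" "x \<in> {0..L}"
  shows "((\<lambda>y. f (t, y)) has_real_derivative partial_x L f t x) (at x within {0..L})"
proof -
  obtain D where D: "(f has_derivative D) (at (t, x) within {0..T} \<times> {0..L})"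
    using assms(1) unfolding differentiable_def by blast
  have sub: "(f has_derivative D) (at (t, x) within Pair t ` {0..L})"
    using assms by (intro has_derivative_subset[OF D]) auto
  have "((\<lambda>y. f (t, y)) has_derivative (\<lambda>h. D (0, h))) (at x within {0..L})"
    by (rule has_derivative_in_compose[OF _ sub]) (auto intro!: derivative_eq_intros)
  then have "(\<lambda>y. f (t, y)) differentiable at x within {0..L}"
    unfolding differentiable_def by blast
  then show ?thesis
    using vector_derivative_works
    by (auto simp: partial_x_def has_real_derivative_iff_has_vector_derivative)
qed

lemma weighted_square_has_derivative:
  assumes "(w has_real_derivative w') (at x within S)" "(f has_real_derivative f') (at x within S)"
  shows "((\<lambda>x. w x * (f x)\<^sup>2) has_real_derivative w' * (f x)\<^sup>2 + 2 * w x * (f x * f'))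
           (at x within S)"
  using assms by (auto intro!: derivative_eq_intros simp: algebra_simps)

lemma C1_on_imp_differentiable:
  assumes "C1_on f S" and "z \<in> S"
  shows "f differentiable at z within S"
  using assms unfolding C1_on_def differentiable_def by blast

lemma C1_on_imp_continuous_on:
  assumes "C1_on f S"
  shows "continuous_on S f"
  by (meson C1_on_imp_differentiable assms differentiable_imp_continuous_within
      continuous_on_eq_continuous_within)

lemma differentiable_comp_pair:
  assumes "C1_on g UNIV" "C1_on f\<^sub>1 S" "C1_on f\<^sub>2 S" "z \<in> S"
  shows "(\<lambda>z. g (f\<^sub>1 z, f\<^sub>2 z)) differentiable at z within S"
proof -
  obtain D\<^sub>1 D\<^sub>2 where D: "(f\<^sub>1 has_derivative D\<^sub>1) (at z within S)"
      "(f\<^sub>2 has_derivative D\<^sub>2) (at z within S)"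
    using C1_on_imp_differentiable assms unfolding differentiable_def by metis
  obtain D where "(g has_derivative D) (at (f\<^sub>1 z, f\<^sub>2 z))"
    using C1_on_imp_differentiable[OF assms(1)] unfolding differentiable_def by blast
  then have "(g has_derivative D) (at (f\<^sub>1 z, f\<^sub>2 z) within (\<lambda>z. (f\<^sub>1 z, f\<^sub>2 z)) ` S)"
    by (rule has_derivative_at_withinI)
  from has_derivative_in_compose[OF has_derivative_Pair[OF D] this]
  show ?thesis
    unfolding differentiable_def by blast
qed

section \<open>Hyperbolic weights\<close>

lemma abs_sinh_less_weighted_cosh:
  fixes \<psi> \<upsilon> L y :: real
  assumes "\<psi> > 0" "(tanh (\<psi> * L))\<^sup>2 < \<upsilon>" "\<bar>y\<bar> \<le> L"
  shows "\<bar>sinh (\<psi> * y)\<bar> < sqrt \<upsilon> * cosh (\<psi> * y)"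
proof -
  have "\<bar>tanh (\<psi> * y)\<bar> = tanh (\<psi> * \<bar>y\<bar>)"
    using \<open>\<psi> > 0\<close> by (cases "y \<ge> 0") (simp_all add: mult_nonneg_nonpos)
  also have "\<dots> \<le> tanh (\<psi> * L)"
    using assms by simp
  also have "\<dots> < sqrt \<upsilon>"
    using assms(2) by (simp add: real_less_rsqrt)
  finally show ?thesis
    by (simp add: tanh_def field_simps abs_mult)
qed

lemma h_pos:
  assumes "\<psi> > 0" "(tanh (\<psi> * L))\<^sup>2 < \<upsilon>" "\<bar>y\<bar> \<le> L"
  shows "h_plus \<psi> \<upsilon> y > 0" "h_minus \<psi> \<upsilon> y > 0"
  using abs_sinh_less_weighted_cosh[OF assms] unfolding h_plus_def h_minus_def by linarith+

lemma h_plus_has_derivative: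
  "(h_plus \<psi> \<upsilon> has_real_derivative
     \<psi> * (sqrt \<upsilon> * sinh (\<psi> * y) - cosh (\<psi> * y))) (at y within S)"
  unfolding h_plus_def
  by (auto intro!: derivative_eq_intros simp: algebra_simps)

lemma h_minus_has_derivative:
  "(h_minus \<psi> \<upsilon> has_real_derivative
     \<psi> * (sqrt \<upsilon> * sinh (\<psi> * y) + cosh (\<psi> * y))) (at y within S)"
  unfolding h_minus_def
  by (auto intro!: derivative_eq_intros simp: algebra_simps)

lemma continuous_on_h [continuous_intros]:
  assumes "continuous_on S f"
  shows "continuous_on S (\<lambda>z. h_plus \<psi> \<upsilon> (f z))" "continuous_on S (\<lambda>z. h_minus \<psi> \<upsilon> (f z))"
  unfolding h_plus_def h_minus_def by (intro continuous_intros assms)+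

text \<open>
  The half-angle formula \<open>tanh (s / 2) = tanh s / (1 + 1 / cosh s)\<close> turns the fraction in the gain
  condition into the ratio of the two weights at an end of the interval, which is the form in which
  the boundary terms produce it.
\<close>

lemma gain_bound_iff:
  assumes "\<psi> > 0" "L > 0" "(tanh (\<psi> * L))\<^sup>2 < \<upsilon>"
  shows "gain_bound L c d \<psi> \<upsilon> k \<longleftrightarrow>
           k\<^sup>2 \<le> c / d * (h_plus \<psi> \<upsilon> (L / 2) / h_minus \<psi> \<upsilon> (L / 2))"
proof -
  define C S where "C = cosh (\<psi> * L / 2)" and "S = sinh (\<psi> * L / 2)"
  have C: "C > 0" by (simp add: C_def)
  have angle: "\<psi> * L = 2 * (\<psi> * L / 2)" by simp
  have cosh2: "cosh (\<psi> * L) = 2 * C\<^sup>2 - 1"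
    unfolding C_def by (subst angle, subst cosh_double_cosh) simp
  have sinh2: "sinh (\<psi> * L) = 2 * S * C"
    unfolding C_def S_def by (subst angle, subst sinh_double) simp
  define D where "D = cosh (\<psi> * L)"
  have D: "D > 0" by (simp add: D_def)
  have one: "1 + 1 / D = 2 * C\<^sup>2 / D"
    using D cosh2[folded D_def] by (simp add: field_simps)
  have th: "tanh (\<psi> * L) = 2 * S * C / D"
    by (simp add: tanh_def sinh2 D_def)
  have num: "sqrt \<upsilon> * (1 + 1 / D) - tanh (\<psi> * L) = (2 * C / D) * (sqrt \<upsilon> * C - S)"
    unfolding one th using D by (simp add: field_simps power2_eq_square)
  have den: "sqrt \<upsilon> * (1 + 1 / D) + tanh (\<psi> * L) = (2 * C / D) * (sqrt \<upsilon> * C + S)"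
    unfolding one th using D by (simp add: field_simps power2_eq_square)
  have "(sqrt \<upsilon> * (1 + 1 / D) - tanh (\<psi> * L)) / (sqrt \<upsilon> * (1 + 1 / D) + tanh (\<psi> * L))
      = (sqrt \<upsilon> * C - S) / (sqrt \<upsilon> * C + S)"
    unfolding num den using C D by (intro mult_divide_mult_cancel_left) simp
  then show ?thesis
    unfolding gain_bound_def h_plus_def h_minus_def
    by (simp add: C_def S_def D_def)
qed

section \<open>Dissipation inside the interval and at its ends\<close>

text \<open>
  Here \<open>C\<close> and \<open>S\<close> stand for \<open>cosh\<close> and \<open>sinh\<close> at one point, \<open>r\<close> for the square root of \<open>\<upsilon>\<close>, and
  \<open>h\<^sub>+ = r C - S\<close>, \<open>h\<^sub>- = r C + S\<close>. The weights satisfy \<open>h\<^sub>\<plusminus>' = \<mp> \<psi> (r h\<^sub>\<plusminus> + (1 - r\<^sup>2) C)\<close>: the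
  first part of the derivative yields the decay rate, and the second part is left over to absorb the
  source terms and the variation of the speeds. Since \<open>h\<^sub>\<plusminus> \<le> 2 r C\<close> and \<open>h\<^sub>+ + h\<^sub>- = 2 r C\<close>, these
  perturbations are at most \<open>(3 M + \<epsilon>) r C (p\<^sup>2 + m\<^sup>2)\<close>, and the hypothesis on the weights says
  exactly that the surplus covers this.
\<close>

lemma pointwise_dissipation:
  fixes p m G\<^sub>p G\<^sub>m C S r c \<psi> M \<epsilon> l\<^sub>p l\<^sub>m l\<^sub>p' l\<^sub>m' :: real
  assumes r: "0 < r" "r \<le> 1" and C: "0 \<le> C" and S: "\<bar>S\<bar> \<le> r * C"
    and \<psi>: "\<psi> > 0" and M: "M \<ge> 0" and \<epsilon>: "\<epsilon> \<ge> 0"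
    and G\<^sub>p: "\<bar>G\<^sub>p\<bar> \<le> M * (\<bar>p\<bar> + \<bar>m\<bar>)" and G\<^sub>m: "\<bar>G\<^sub>m\<bar> \<le> M * (\<bar>p\<bar> + \<bar>m\<bar>)"
    and l: "c \<le> l\<^sub>p" "l\<^sub>m \<le> - c" "\<bar>l\<^sub>p'\<bar> \<le> \<epsilon>" "\<bar>l\<^sub>m'\<bar> \<le> \<epsilon>"
    and absorb: "(3 * M + \<epsilon>) * r \<le> c * \<psi> / 2 * (1 - r\<^sup>2)"
  shows "(r * C - S) * (p * G\<^sub>p) + (r * C + S) * (m * G\<^sub>m)
      + ((\<psi> * (r * S - C) * l\<^sub>p + (r * C - S) * l\<^sub>p') * p\<^sup>2
        + (\<psi> * (r * S + C) * l\<^sub>m + (r * C + S) * l\<^sub>m') * m\<^sup>2) / 2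
    \<le> - (c * \<psi> * r) * (((r * C - S) * p\<^sup>2 + (r * C + S) * m\<^sup>2) / 2)"
proof -
  define H K where "H = r * C - S" and "K = r * C + S"
  have HK: "0 \<le> H" "0 \<le> K" "H \<le> 2 * r * C" "K \<le> 2 * r * C" "H + K = 2 * r * C"
    using S unfolding H_def K_def by linarith+
  have r2: "r\<^sup>2 \<le> 1"
    using r by (simp add: power_le_one)
  have dH: "\<psi> * (r * S - C) = - \<psi> * (r * H + (1 - r\<^sup>2) * C)"
    and dK: "\<psi> * (r * S + C) = \<psi> * (r * K + (1 - r\<^sup>2) * C)"
    by (simp_all add: H_def K_def algebra_simps power2_eq_square)
  have src_p: "H * (p * G\<^sub>p) \<le> H * (M * (p\<^sup>2 + \<bar>p\<bar> * \<bar>m\<bar>))"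
  proof (rule mult_left_mono[OF _ HK(1)])
    have "p * G\<^sub>p \<le> \<bar>p\<bar> * \<bar>G\<^sub>p\<bar>"
      by (metis abs_ge_self abs_mult)
    also have "\<dots> \<le> \<bar>p\<bar> * (M * (\<bar>p\<bar> + \<bar>m\<bar>))"
      by (intro mult_left_mono G\<^sub>p) simp
    finally show "p * G\<^sub>p \<le> M * (p\<^sup>2 + \<bar>p\<bar> * \<bar>m\<bar>)"
      by (simp add: algebra_simps power2_eq_square)
  qed
  have src_m: "K * (m * G\<^sub>m) \<le> K * (M * (m\<^sup>2 + \<bar>p\<bar> * \<bar>m\<bar>))"
  proof (rule mult_left_mono[OF _ HK(2)])
    have "m * G\<^sub>m \<le> \<bar>m\<bar> * \<bar>G\<^sub>m\<bar>"
      by (metis abs_ge_self abs_mult)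
    also have "\<dots> \<le> \<bar>m\<bar> * (M * (\<bar>p\<bar> + \<bar>m\<bar>))"
      by (intro mult_left_mono G\<^sub>m) simp
    finally show "m * G\<^sub>m \<le> M * (m\<^sup>2 + \<bar>p\<bar> * \<bar>m\<bar>)"
      by (simp add: algebra_simps power2_eq_square)
  qed
  have nnH: "0 \<le> \<psi> * (r * H + (1 - r\<^sup>2) * C)" and nnK: "0 \<le> \<psi> * (r * K + (1 - r\<^sup>2) * C)"
    using HK r r2 C \<psi> by simp_all
  have "(\<psi> * (r * S - C) * l\<^sub>p + H * l\<^sub>p') \<le> - (c * (\<psi> * (r * H + (1 - r\<^sup>2) * C))) + \<epsilon> * H"
    using mult_right_mono[OF l(1) nnH] mult_right_mono[OF abs_le_D1[OF l(3)] HK(1)]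
    unfolding dH by (simp add: mult.commute)
  from mult_right_mono[OF this, of "p\<^sup>2"]
  have flux_p: "(\<psi> * (r * S - C) * l\<^sub>p + H * l\<^sub>p') * p\<^sup>2
      \<le> (- (c * (\<psi> * (r * H + (1 - r\<^sup>2) * C))) + \<epsilon> * H) * p\<^sup>2" by simp
  have "(\<psi> * (r * S + C) * l\<^sub>m + K * l\<^sub>m') \<le> - (c * (\<psi> * (r * K + (1 - r\<^sup>2) * C))) + \<epsilon> * K"
    using mult_right_mono[OF l(2) nnK] mult_right_mono[OF abs_le_D1[OF l(4)] HK(2)]
    unfolding dK by (simp add: mult.commute)
  from mult_right_mono[OF this, of "m\<^sup>2"]
  have flux_m: "(\<psi> * (r * S + C) * l\<^sub>m + K * l\<^sub>m') * m\<^sup>2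
      \<le> (- (c * (\<psi> * (r * K + (1 - r\<^sup>2) * C))) + \<epsilon> * K) * m\<^sup>2" by simp
  have weights: "H * p\<^sup>2 + K * m\<^sup>2 \<le> 2 * r * C * (p\<^sup>2 + m\<^sup>2)"
    using mult_right_mono[OF HK(3), of "p\<^sup>2"] mult_right_mono[OF HK(4), of "m\<^sup>2"]
    by (simp add: algebra_simps)
  have young: "2 * (\<bar>p\<bar> * \<bar>m\<bar>) \<le> p\<^sup>2 + m\<^sup>2"
    using sum_squares_bound[of "\<bar>p\<bar>" "\<bar>m\<bar>"] by simp
  have rC: "0 \<le> r * C" using r C by simp
  have "H * p\<^sup>2 + K * m\<^sup>2 + (H + K) * (\<bar>p\<bar> * \<bar>m\<bar>) \<le> 3 * (r * C) * (p\<^sup>2 + m\<^sup>2)"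
    using weights mult_left_mono[OF young rC] unfolding HK(5) by (simp add: algebra_simps)
  from mult_left_mono[OF this M]
  have src: "M * (H * p\<^sup>2 + K * m\<^sup>2 + (H + K) * (\<bar>p\<bar> * \<bar>m\<bar>))
      \<le> M * (3 * (r * C) * (p\<^sup>2 + m\<^sup>2))" .
  have var: "\<epsilon> * (H * p\<^sup>2 + K * m\<^sup>2) \<le> \<epsilon> * (2 * r * C * (p\<^sup>2 + m\<^sup>2))"
    by (rule mult_left_mono[OF weights \<epsilon>])
  have surplus: "(3 * M + \<epsilon>) * r * (C * (p\<^sup>2 + m\<^sup>2)) \<le> c * \<psi> / 2 * (1 - r\<^sup>2) * (C * (p\<^sup>2 + m\<^sup>2))"
    using C by (intro mult_right_mono[OF absorb]) simp
  have "H * (p * G\<^sub>p) + K * (m * G\<^sub>m)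
      + ((\<psi> * (r * S - C) * l\<^sub>p + H * l\<^sub>p') * p\<^sup>2 + (\<psi> * (r * S + C) * l\<^sub>m + K * l\<^sub>m') * m\<^sup>2) / 2
    \<le> H * (M * (p\<^sup>2 + \<bar>p\<bar> * \<bar>m\<bar>)) + K * (M * (m\<^sup>2 + \<bar>p\<bar> * \<bar>m\<bar>))
      + ((- (c * (\<psi> * (r * H + (1 - r\<^sup>2) * C))) + \<epsilon> * H) * p\<^sup>2
        + (- (c * (\<psi> * (r * K + (1 - r\<^sup>2) * C))) + \<epsilon> * K) * m\<^sup>2) / 2"
    by (intro add_mono divide_right_mono src_p src_m flux_p flux_m) simp
  also have "\<dots> = - (c * \<psi> * r) * ((H * p\<^sup>2 + K * m\<^sup>2) / 2)
      + M * (H * p\<^sup>2 + K * m\<^sup>2 + (H + K) * (\<bar>p\<bar> * \<bar>m\<bar>)) + \<epsilon> * (H * p\<^sup>2 + K * m\<^sup>2) / 2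
      - c * \<psi> / 2 * (1 - r\<^sup>2) * (C * (p\<^sup>2 + m\<^sup>2))"
    by (simp add: field_simps)
  also have "\<dots> \<le> - (c * \<psi> * r) * ((H * p\<^sup>2 + K * m\<^sup>2) / 2)
      + M * (3 * (r * C) * (p\<^sup>2 + m\<^sup>2)) + \<epsilon> * (2 * r * C * (p\<^sup>2 + m\<^sup>2)) / 2
      - (3 * M + \<epsilon>) * r * (C * (p\<^sup>2 + m\<^sup>2))"
    using src var surplus by linarith
  also have "\<dots> = - (c * \<psi> * r) * ((H * p\<^sup>2 + K * m\<^sup>2) / 2)"
    by (simp add: field_simps)
  finally show ?thesis
    by (simp add: H_def K_def)
qed

text \<open>
  At each end one component leaves the interval and the other enters as its reflection, with gain
  \<open>k\<close>. The outgoing component carries away at least \<open>A c q\<^sup>2\<close> and the reflected one brings back at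
  most \<open>B d k\<^sup>2 q\<^sup>2\<close>, where \<open>A\<close> and \<open>B\<close> are the two weights there; a small gain makes the balance a
  loss.
\<close>

lemma boundary_dissipation:
  fixes A B c d k l\<^sub>o l\<^sub>i q :: real
  assumes "A > 0" "B > 0" "d > 0" "k\<^sup>2 \<le> c / d * (A / B)" "c \<le> l\<^sub>o" "l\<^sub>i \<le> d"
  shows "B * l\<^sub>i * (k * q)\<^sup>2 \<le> A * l\<^sub>o * q\<^sup>2"
proof -
  have "B * l\<^sub>i * k\<^sup>2 \<le> B * d * k\<^sup>2"
    using assms by (intro mult_right_mono mult_left_mono) auto
  also have "\<dots> \<le> A * c"
    using assms by (simp add: field_simps)
  also have "\<dots> \<le> A * l\<^sub>o"
    using assms by simp
  finally have "B * l\<^sub>i * k\<^sup>2 \<le> A * l\<^sub>o" .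
  from mult_right_mono[OF this, of "q\<^sup>2"] show ?thesis
    by (simp add: power_mult_distrib algebra_simps)
qed

section \<open>The Lyapunov function along a solution\<close>

lemma lyapunov_has_derivative:
  assumes p: "C1_on p ({0..T} \<times> {0..L})" and m: "C1_on m ({0..T} \<times> {0..L})"
    and "T > 0" "L > 0" and t: "t \<in> {0..T}"
  shows "(lyapunov L \<psi> \<upsilon> p m has_real_derivative
       integral {0..L} (\<lambda>x. h_plus \<psi> \<upsilon> (x - L / 2) * (p (t, x) * partial_t T p t x)
                          + h_minus \<psi> \<upsilon> (x - L / 2) * (m (t, x) * partial_t T m t x)))
     (at t within {0..T})"
proof -
  let ?R = "{0..T} \<times> {0..L}"
  define e where "e t x = (h_plus \<psi> \<upsilon> (x - L / 2) * (p (t, x))\<^sup>2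
      + h_minus \<psi> \<upsilon> (x - L / 2) * (m (t, x))\<^sup>2) / 2" for t x
  define e' where "e' t x = h_plus \<psi> \<upsilon> (x - L / 2) * (p (t, x) * partial_t T p t x)
      + h_minus \<psi> \<upsilon> (x - L / 2) * (m (t, x) * partial_t T m t x)" for t x
  have lyap: "lyapunov L \<psi> \<upsilon> p m = (\<lambda>t. integral (cbox 0 L) (e t))"
    unfolding lyapunov_def e_def by (simp add: fun_eq_iff)
  note cp = C1_on_imp_continuous_on[OF p] and cm = C1_on_imp_continuous_on[OF m]
  have cx: "continuous_on {0..L} (\<lambda>x. f (t, x))"
    if "continuous_on ?R f" "t \<in> {0..T}" for f :: "real \<times> real \<Rightarrow> real" and t
    by (rule continuous_on_compose2[OF that(1)]) (use that in \<open>auto intro!: continuous_intros\<close>)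
  have 0: "0 \<in> {0..L}" using \<open>L > 0\<close> by simp
  have "((\<lambda>t. integral (cbox 0 L) (e t)) has_real_derivative integral (cbox 0 L) (e' t))
      (at t within {0..T})"
  proof (rule leibniz_rule_field_derivative)
    fix s x assume s: "s \<in> {0..T}" and "x \<in> cbox 0 L"
    then have x: "x \<in> {0..L}" by simp
    show "((\<lambda>s. e s x) has_real_derivative e' s x) (at s within {0..T})"
      unfolding e_def e'_def
      by (rule DERIV_cong[OF DERIV_cdivide[OF DERIV_add[OF
              weighted_square_has_derivative[OF DERIV_const C1_on_partial_t(1)[OF p \<open>T > 0\<close> s x]]
              weighted_square_has_derivative[OF DERIV_const C1_on_partial_t(1)[OF m \<open>T > 0\<close> s x]]]]])
        simp
  next
    fix s assume s: "s \<in> {0..T}"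
    have "continuous_on {0..L} (e s)"
      unfolding e_def by (intro continuous_intros cx[OF cp s] cx[OF cm s]) auto
    then show "e s integrable_on cbox 0 L"
      by (simp add: integrable_continuous_interval)
  next
    have "continuous_on ?R (\<lambda>z. h_plus \<psi> \<upsilon> (snd z - L / 2) * (p z * partial_t T p (fst z) (snd z))
        + h_minus \<psi> \<upsilon> (snd z - L / 2) * (m z * partial_t T m (fst z) (snd z)))"
      by (intro continuous_intros cp cm C1_on_partial_t(2)[OF p \<open>T > 0\<close> t 0]
          C1_on_partial_t(2)[OF m \<open>T > 0\<close> t 0])
    then show "continuous_on ({0..T} \<times> cbox 0 L) (\<lambda>(s, x). e' s x)"
      by (simp add: e'_def case_prod_beta)
  qed (use t in auto)
  then show ?thesis
    unfolding lyap e'_def by simp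
qed

text \<open>
  Replacing the time derivatives by the equations turns the derivative of the Lyapunov function into
  source terms minus the transport terms \<open>h \<lambda> \<delta> \<partial>\<^sub>x\<delta>\<close>. These are, up to terms without \<open>\<partial>\<^sub>x\<delta>\<close>, the
  space derivative of the flux \<open>(h\<^sub>+ \<lambda>\<^sub>+ \<delta>\<^sub>+\<^sup>2 + h\<^sub>- \<lambda>\<^sub>- \<delta>\<^sub>-\<^sup>2) / 2\<close>. Adding that derivative leaves the
  integrand of the pointwise estimate, and its integral, the flux difference between the two ends, is
  nonnegative by the boundary conditions.
\<close>

lemma lyapunov_derivative_le:
  assumes "L > 0" "T > 0" "M > 0" "\<epsilon>\<^sub>0 > 0" "c > 0" "c \<le> d" "\<psi> > 0"
    and \<upsilon>: "(tanh (\<psi> * L))\<^sup>2 < \<upsilon>" "\<upsilon> \<le> 1"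
    and weights: "weight_choice L \<epsilon>\<^sub>0 M c \<psi> \<upsilon>"
    and gains: "gain_bound L c d \<psi> \<upsilon> k\<^sub>0" "gain_bound L c d \<psi> \<upsilon> k\<^sub>L"
    and lam: "C1_on lamp UNIV" "C1_on lamm UNIV"
    and G: "source_bound M Gp" "source_bound M Gm"
    and sol: "classical_solution T L k\<^sub>0 k\<^sub>L lamp lamm Gp Gm p m"
    and speeds: "speed_bounds T L \<epsilon>\<^sub>0 c d lamp lamm p m"
    and t: "t \<in> {0..T}"
  shows "integral {0..L} (\<lambda>x. h_plus \<psi> \<upsilon> (x - L / 2) * (p (t, x) * partial_t T p t x)
                          + h_minus \<psi> \<upsilon> (x - L / 2) * (m (t, x) * partial_t T m t x))
       \<le> - (c * \<psi> * sqrt \<upsilon>) * lyapunov L \<psi> \<upsilon> p m t"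
proof -
  let ?R = "{0..T} \<times> {0..L}"
  have p: "C1_on p ?R" and m: "C1_on m ?R"
    using sol unfolding classical_solution_def by blast+
  have \<upsilon>0: "\<upsilon> > 0"
    using \<upsilon>(1) zero_le_power2[of "tanh (\<psi> * L)"] by linarith
  have sp: "\<bar>partial_x L (\<lambda>z. lamp (p z, m z)) t x\<bar> \<le> \<epsilon>\<^sub>0"
      "\<bar>partial_x L (\<lambda>z. lamm (p z, m z)) t x\<bar> \<le> \<epsilon>\<^sub>0"
      "- d \<le> lamm (p (t, x), m (t, x))" "lamm (p (t, x), m (t, x)) \<le> - c"
      "c \<le> lamp (p (t, x), m (t, x))" "lamp (p (t, x), m (t, x)) \<le> d" if "x \<in> {0..L}" for x
    using speeds t that unfolding speed_bounds_def by blast+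
  have pde: "partial_t T p t x
        = Gp (p (t, x), m (t, x)) - lamp (p (t, x), m (t, x)) * partial_x L p t x"
      "partial_t T m t x
        = Gm (p (t, x), m (t, x)) - lamm (p (t, x), m (t, x)) * partial_x L m t x"
    if "x \<in> {0..L}" for x
    using sol t that unfolding classical_solution_def eq_diff_eq by blast+
  have bc: "p (t, 0) = k\<^sub>0 * m (t, 0)" "m (t, L) = k\<^sub>L * p (t, L)"
    using sol t unfolding classical_solution_def by blast+
  have absorb: "(3 * M + \<epsilon>\<^sub>0) * sqrt \<upsilon> \<le> c * \<psi> / 2 * (1 - (sqrt \<upsilon>)\<^sup>2)"
  proof -
    have "L * (3 * M + \<epsilon>\<^sub>0) \<le> L * (c * \<psi> / 2 * (1 / sqrt \<upsilon> - sqrt \<upsilon>))"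
      using weights unfolding weight_choice_def by (simp add: algebra_simps)
    then have "3 * M + \<epsilon>\<^sub>0 \<le> c * \<psi> / 2 * (1 / sqrt \<upsilon> - sqrt \<upsilon>)"
      using \<open>L > 0\<close> by (simp only: mult_le_cancel_left_pos)
    from mult_right_mono[OF this, of "sqrt \<upsilon>"] show ?thesis
      using \<upsilon>0 by (simp add: algebra_simps power2_eq_square)
  qed
  define e where "e x = (h_plus \<psi> \<upsilon> (x - L / 2) * (p (t, x))\<^sup>2
      + h_minus \<psi> \<upsilon> (x - L / 2) * (m (t, x))\<^sup>2) / 2" for x
  define e' where "e' x = h_plus \<psi> \<upsilon> (x - L / 2) * (p (t, x) * partial_t T p t x)
      + h_minus \<psi> \<upsilon> (x - L / 2) * (m (t, x) * partial_t T m t x)" for x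
  define \<Phi> where "\<Phi> x = (h_plus \<psi> \<upsilon> (x - L / 2) * lamp (p (t, x), m (t, x)) * (p (t, x))\<^sup>2
      + h_minus \<psi> \<upsilon> (x - L / 2) * lamm (p (t, x), m (t, x)) * (m (t, x))\<^sup>2) / 2" for x
  define S C where "S x = sinh (\<psi> * (x - L / 2))" and "C x = cosh (\<psi> * (x - L / 2))" for x
  define \<Phi>' where "\<Phi>' x =
      ((\<psi> * (sqrt \<upsilon> * S x - C x) * lamp (p (t, x), m (t, x))
          + h_plus \<psi> \<upsilon> (x - L / 2) * partial_x L (\<lambda>z. lamp (p z, m z)) t x) * (p (t, x))\<^sup>2
       + (\<psi> * (sqrt \<upsilon> * S x + C x) * lamm (p (t, x), m (t, x))
          + h_minus \<psi> \<upsilon> (x - L / 2) * partial_x L (\<lambda>z. lamm (p z, m z)) t x) * (m (t, x))\<^sup>2) / 2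
      + h_plus \<psi> \<upsilon> (x - L / 2) * lamp (p (t, x), m (t, x)) * (p (t, x) * partial_x L p t x)
      + h_minus \<psi> \<upsilon> (x - L / 2) * lamm (p (t, x), m (t, x)) * (m (t, x) * partial_x L m t x)"
    for x
  have d\<Phi>: "(\<Phi> has_real_derivative \<Phi>' x) (at x within {0..L})" if x: "x \<in> {0..L}" for x
  proof -
    have tx: "(t, x) \<in> ?R" using t x by simp
    note dx = has_partial_x[OF _ \<open>L > 0\<close> t x]
    have shift: "((\<lambda>x. x - L / 2) has_real_derivative 1) (at x within {0..L})"
      by (auto intro!: derivative_eq_intros)
    have dh: "((\<lambda>x. h_plus \<psi> \<upsilon> (x - L / 2)) has_real_derivative
          \<psi> * (sqrt \<upsilon> * S x - C x)) (at x within {0..L})"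
        "((\<lambda>x. h_minus \<psi> \<upsilon> (x - L / 2)) has_real_derivative
          \<psi> * (sqrt \<upsilon> * S x + C x)) (at x within {0..L})"
      unfolding S_def C_def
      using DERIV_chain2[OF h_plus_has_derivative shift] DERIV_chain2[OF h_minus_has_derivative shift]
      by simp_all
    have sum: "((a\<^sub>1 * l\<^sub>1 + b\<^sub>1 * h\<^sub>1) * P + 2 * (h\<^sub>1 * l\<^sub>1) * X
          + ((a\<^sub>2 * l\<^sub>2 + b\<^sub>2 * h\<^sub>2) * Q + 2 * (h\<^sub>2 * l\<^sub>2) * Y)) / 2
        = ((a\<^sub>1 * l\<^sub>1 + h\<^sub>1 * b\<^sub>1) * P + (a\<^sub>2 * l\<^sub>2 + h\<^sub>2 * b\<^sub>2) * Q) / 2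
          + h\<^sub>1 * l\<^sub>1 * X + h\<^sub>2 * l\<^sub>2 * Y"
      for a\<^sub>1 a\<^sub>2 b\<^sub>1 b\<^sub>2 h\<^sub>1 h\<^sub>2 l\<^sub>1 l\<^sub>2 P Q X Y :: real
      by (simp add: field_simps)
    show ?thesis
      unfolding \<Phi>_def \<Phi>'_def
      by (rule DERIV_cong[OF DERIV_cdivide[OF DERIV_add[OF
              weighted_square_has_derivative[OF
                DERIV_mult[OF dh(1) dx[OF differentiable_comp_pair[OF lam(1) p m tx]]]
                dx[OF C1_on_imp_differentiable[OF p tx]]]
              weighted_square_has_derivative[OF
                DERIV_mult[OF dh(2) dx[OF differentiable_comp_pair[OF lam(2) p m tx]]]
                dx[OF C1_on_imp_differentiable[OF m tx]]]]]])
        (rule sum)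
  qed
  have int\<Phi>: "(\<Phi>' has_integral (\<Phi> L - \<Phi> 0)) {0..L}"
    using \<open>L > 0\<close> d\<Phi>
    by (intro fundamental_theorem_of_calculus)
      (auto simp: has_real_derivative_iff_has_vector_derivative)
  have pointwise: "e' x + \<Phi>' x \<le> - (c * \<psi> * sqrt \<upsilon>) * e x" if x: "x \<in> {0..L}" for x
  proof -
    have "\<bar>x - L / 2\<bar> \<le> L" using x by (auto simp: abs_if)
    then have S: "\<bar>S x\<bar> \<le> sqrt \<upsilon> * C x"
      unfolding S_def C_def
      using abs_sinh_less_weighted_cosh[OF \<open>\<psi> > 0\<close> \<upsilon>(1)] less_imp_le by blast
    have h: "h_plus \<psi> \<upsilon> (x - L / 2) = sqrt \<upsilon> * C x - S x"
        "h_minus \<psi> \<upsilon> (x - L / 2) = sqrt \<upsilon> * C x + S x"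
      by (simp_all add: h_plus_def h_minus_def S_def C_def)
    have src: "\<bar>Gp (p (t, x), m (t, x))\<bar> \<le> M * (\<bar>p (t, x)\<bar> + \<bar>m (t, x)\<bar>)"
        "\<bar>Gm (p (t, x), m (t, x))\<bar> \<le> M * (\<bar>p (t, x)\<bar> + \<bar>m (t, x)\<bar>)"
      using G unfolding source_bound_def by auto
    have C: "0 \<le> C x" by (simp add: C_def)
    have r: "0 < sqrt \<upsilon>" "sqrt \<upsilon> \<le> 1" using \<upsilon>0 \<upsilon>(2) by auto
    note estimate = pointwise_dissipation[OF r C S \<open>\<psi> > 0\<close> less_imp_le[OF \<open>M > 0\<close>]
        less_imp_le[OF \<open>\<epsilon>\<^sub>0 > 0\<close>] src sp(5)[OF x] sp(4)[OF x] sp(1)[OF x] sp(2)[OF x] absorb]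
    have cancel: "H * (a * (g - l * q)) + K * (b * (g' - l' * q'))
        + (Z + H * l * (a * q) + K * l' * (b * q')) = H * (a * g) + K * (b * g') + Z"
      for H K a b g g' l l' q q' Z :: real
      by (simp add: algebra_simps)
    have "e' x + \<Phi>' x =
        (sqrt \<upsilon> * C x - S x) * (p (t, x) * Gp (p (t, x), m (t, x)))
      + (sqrt \<upsilon> * C x + S x) * (m (t, x) * Gm (p (t, x), m (t, x)))
      + ((\<psi> * (sqrt \<upsilon> * S x - C x) * lamp (p (t, x), m (t, x))
            + (sqrt \<upsilon> * C x - S x) * partial_x L (\<lambda>z. lamp (p z, m z)) t x) * (p (t, x))\<^sup>2
        + (\<psi> * (sqrt \<upsilon> * S x + C x) * lamm (p (t, x), m (t, x))
            + (sqrt \<upsilon> * C x + S x) * partial_x L (\<lambda>z. lamm (p z, m z)) t x) * (m (t, x))\<^sup>2) / 2"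
      unfolding e'_def \<Phi>'_def pde[OF x] h by (rule cancel)
    also have "\<dots> \<le> - (c * \<psi> * sqrt \<upsilon>) * e x"
      using estimate unfolding e_def h .
    finally show ?thesis .
  qed
  have flux: "\<Phi> 0 \<le> \<Phi> L"
  proof -
    define A B where "A = h_plus \<psi> \<upsilon> (L / 2)" and "B = h_minus \<psi> \<upsilon> (L / 2)"
    have AB: "A > 0" "B > 0"
      unfolding A_def B_def using h_pos[OF \<open>\<psi> > 0\<close> \<upsilon>(1)] \<open>L > 0\<close> by auto
    \<comment> \<open>Reflection about the midpoint exchanges the two weights, so that one gain condition serves
      both ends.\<close>
    have swap: "h_plus \<psi> \<upsilon> (0 - L / 2) = B" "h_minus \<psi> \<upsilon> (0 - L / 2) = A"
        "h_plus \<psi> \<upsilon> (L - L / 2) = A" "h_minus \<psi> \<upsilon> (L - L / 2) = B"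
      by (simp_all add: A_def B_def h_plus_def h_minus_def)
    have k: "k\<^sub>0\<^sup>2 \<le> c / d * (A / B)" "k\<^sub>L\<^sup>2 \<le> c / d * (A / B)"
      using gains gain_bound_iff[OF \<open>\<psi> > 0\<close> \<open>L > 0\<close> \<upsilon>(1)] unfolding A_def B_def by blast+
    have d: "d > 0" using \<open>c > 0\<close> \<open>c \<le> d\<close> by simp
    have ends: "0 \<in> {0..L}" "L \<in> {0..L}" using \<open>L > 0\<close> by auto
    have at_0: "B * lamp (p (t, 0), m (t, 0)) * (k\<^sub>0 * m (t, 0))\<^sup>2
        \<le> A * - lamm (p (t, 0), m (t, 0)) * (m (t, 0))\<^sup>2"
      using sp[OF ends(1)] by (intro boundary_dissipation[OF AB d k(1)]) auto
    have at_L: "B * - lamm (p (t, L), m (t, L)) * (k\<^sub>L * p (t, L))\<^sup>2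
        \<le> A * lamp (p (t, L), m (t, L)) * (p (t, L))\<^sup>2"
      using sp[OF ends(2)] by (intro boundary_dissipation[OF AB d k(2)]) auto
    have "\<Phi> 0 \<le> 0"
      using at_0 unfolding \<Phi>_def swap bc(1)[symmetric] by simp
    moreover have "0 \<le> \<Phi> L"
      using at_L unfolding \<Phi>_def swap bc(2)[symmetric] by simp
    ultimately show ?thesis by simp
  qed
  have cx: "continuous_on {0..L} (\<lambda>x. f (t, x))" if "continuous_on ?R f"
    for f :: "real \<times> real \<Rightarrow> real"
    by (rule continuous_on_compose2[OF that]) (use t in \<open>auto intro!: continuous_intros\<close>)
  have 0: "0 \<in> {0..L}" using \<open>L > 0\<close> by simp
  note cp = cx[OF C1_on_imp_continuous_on[OF p]] and cm = cx[OF C1_on_imp_continuous_on[OF m]]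
  have "continuous_on {0..L} e"
    unfolding e_def by (intro continuous_intros cp cm) auto
  then have int_e: "e integrable_on {0..L}"
    by (rule integrable_continuous_interval)
  have "continuous_on {0..L} e'"
    unfolding e'_def
    using cx[OF C1_on_partial_t(2)[OF p \<open>T > 0\<close> t 0]] cx[OF C1_on_partial_t(2)[OF m \<open>T > 0\<close> t 0]]
    by (intro continuous_intros cp cm) auto
  then have int_e': "e' integrable_on {0..L}"
    by (rule integrable_continuous_interval)
  have "integral {0..L} e' \<le> integral {0..L} e' + (\<Phi> L - \<Phi> 0)"
    using flux by simp
  also have "\<dots> \<le> - (c * \<psi> * sqrt \<upsilon>) * integral {0..L} e"
    by (rule has_integral_le[OF
          has_integral_add[OF integrable_integral[OF int_e'] int\<Phi>]
          has_integral_mult_right[OF integrable_integral[OF int_e]] pointwise])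
  also have "integral {0..L} e = lyapunov L \<psi> \<upsilon> p m t"
    unfolding e_def lyapunov_def by simp
  finally show ?thesis
    unfolding e'_def .
qed

lemma exponential_decay:
  fixes E :: "real \<Rightarrow> real"
  assumes E: "\<And>t. t \<in> {0..T} \<Longrightarrow> (E has_real_derivative E' t) (at t within {0..T})"
    and le: "\<And>t. t \<in> {0..T} \<Longrightarrow> E' t \<le> - \<mu> * E t"
    and t: "t \<in> {0..T}"
  shows "E t \<le> exp (- \<mu> * t) * E 0"
proof -
  have deriv: "((\<lambda>s. exp (\<mu> * s) * E s) has_real_derivative exp (\<mu> * s) * (E' s + \<mu> * E s))
      (at s within {0..T})" if "s \<in> {0..T}" for s
    using E[OF that] by (auto intro!: derivative_eq_intros simp: algebra_simps)
  have "exp (\<mu> * t) * E t \<le> exp (\<mu> * 0) * E 0"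
  proof (rule DERIV_nonpos_imp_decreasing_open[where f = "\<lambda>s. exp (\<mu> * s) * E s"])
    fix s assume "0 < s" "s < t"
    then have s: "s \<in> {0..T}" "s \<in> interior {0..T}" using t by auto
    show "\<exists>y. ((\<lambda>s. exp (\<mu> * s) * E s) has_real_derivative y) (at s) \<and> y \<le> 0"
      using deriv[OF s(1)] le[OF s(1)] at_within_interior[OF s(2)]
      by (auto intro!: exI[of _ "exp (\<mu> * s) * (E' s + \<mu> * E s)"] mult_nonneg_nonpos)
  next
    have "continuous_on {0..T} (\<lambda>s. exp (\<mu> * s) * E s)"
      using deriv DERIV_continuous by (fastforce simp: continuous_on_eq_continuous_within)
    then show "continuous_on {0..t} (\<lambda>s. exp (\<mu> * s) * E s)"
      by (rule continuous_on_subset) (use t in auto)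
  qed (use t in auto)
  then show ?thesis
    by (simp add: exp_minus field_simps)
qed

theorem lyapunov_decay:
  assumes "L > 0" "T > 0" "M > 0" "\<epsilon>\<^sub>0 > 0" "c > 0" "c \<le> d" "\<psi> > 0"
    and "(tanh (\<psi> * L))\<^sup>2 < \<upsilon>" "\<upsilon> \<le> 1"
    and "weight_choice L \<epsilon>\<^sub>0 M c \<psi> \<upsilon>"
    and "gain_bound L c d \<psi> \<upsilon> k\<^sub>0" "gain_bound L c d \<psi> \<upsilon> k\<^sub>L"
    and "C1_on lamp UNIV" "C1_on lamm UNIV"
    and "source_bound M Gp" "source_bound M Gm"
    and sol: "classical_solution T L k\<^sub>0 k\<^sub>L lamp lamm Gp Gm p m"
    and "speed_bounds T L \<epsilon>\<^sub>0 c d lamp lamm p m"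
    and "t \<in> {0..T}"
  shows "lyapunov L \<psi> \<upsilon> p m t \<le> exp (- (c * \<psi> * sqrt \<upsilon>) * t) * lyapunov L \<psi> \<upsilon> p m 0"
proof -
  have C1: "C1_on p ({0..T} \<times> {0..L})" "C1_on m ({0..T} \<times> {0..L})"
    using sol unfolding classical_solution_def by blast+
  show ?thesis
    by (rule exponential_decay[OF lyapunov_has_derivative[OF C1 assms(2,1)]
          lyapunov_derivative_le[OF assms(1-18)] assms(19)])
qed

section \<open>Choice of the weights and of the gain threshold\<close>

lemma tanh_less_self:
  fixes s :: real
  assumes "s > 0"
  shows "tanh s < s"
proof -
  have "\<exists>y. ((\<lambda>s. s - tanh s) has_real_derivative y) (at x) \<and> 0 < y" if "0 < x" "x < s" for x :: real
    using that by (intro exI[of _ "(tanh x)\<^sup>2"]) (auto intro!: derivative_eq_intros)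
  moreover have "continuous_on {0..s} (\<lambda>s. s - tanh s)"
    by (intro continuous_intros) auto
  ultimately have "0 - tanh 0 < s - tanh s"
    by (rule DERIV_pos_imp_increasing_open[OF assms])
  then show ?thesis by simp
qed

text \<open>
  With \<open>s = \<psi> L\<close> and \<open>\<upsilon> = s\<^sup>2\<close> the condition on the weights reads \<open>a \<le> s (1 / s - s) = 1 - s\<^sup>2\<close> for
  \<open>a = (2 \<epsilon>\<^sub>0 + 6 M) L / c\<close>, which is below \<open>1\<close>. So \<open>s = sqrt (1 - a)\<close> is admissible, and \<open>\<upsilon>\<close> exceeds
  \<open>tanh\<^sup>2 s\<close> because \<open>tanh s < s\<close>.
\<close>

lemma weight_choice_exists:
  assumes "L > 0" "\<epsilon>\<^sub>0 > 0" "M > 0" "c > 0" "(2 * \<epsilon>\<^sub>0 + 6 * M) * L < c"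
  shows "\<exists>\<psi> \<upsilon>. \<psi> > 0 \<and> \<upsilon> \<in> {(tanh (\<psi> * L))\<^sup>2<..1} \<and> weight_choice L \<epsilon>\<^sub>0 M c \<psi> \<upsilon>"
proof -
  define a where "a = (2 * \<epsilon>\<^sub>0 + 6 * M) * L / c"
  define s where "s = sqrt (1 - a)"
  have a: "0 < a" "a < 1"
    using assms by (simp_all add: a_def)
  have s: "s > 0" "s\<^sup>2 = 1 - a"
    using a by (simp_all add: s_def)
  have "(tanh s)\<^sup>2 < s\<^sup>2"
    using tanh_less_self[OF s(1)] s(1) by (intro power_strict_mono) auto
  moreover have "c / 2 * s * (1 / s - s) = 3 * M * L + \<epsilon>\<^sub>0 * L"
  proof -
    have "c / 2 * s * (1 / s - s) = c / 2 * (1 - s\<^sup>2)"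
      using s(1) by (simp add: field_simps power2_eq_square)
    also have "\<dots> = c / 2 * a"
      by (simp add: s(2))
    also have "\<dots> = 3 * M * L + \<epsilon>\<^sub>0 * L"
      using \<open>c > 0\<close> by (simp add: a_def field_simps)
    finally show ?thesis .
  qed
  moreover have "s\<^sup>2 \<le> 1"
    using s(2) a by simp
  ultimately show ?thesis
    using s(1) \<open>L > 0\<close>
    by - (rule exI[of _ "s / L"], rule exI[of _ "s\<^sup>2"], auto simp: weight_choice_def)
qed

lemma small_gains_satisfy_gain_bound:
  assumes "L > 0" "c > 0" "c \<le> d" "\<psi> > 0" "(tanh (\<psi> * L))\<^sup>2 < \<upsilon>"
  shows "\<exists>\<kappa>>0. \<forall>k. \<bar>k\<bar> \<le> \<kappa> \<longrightarrow> gain_bound L c d \<psi> \<upsilon> k"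
proof -
  define q where "q = c / d * (h_plus \<psi> \<upsilon> (L / 2) / h_minus \<psi> \<upsilon> (L / 2))"
  have "q > 0"
    unfolding q_def using assms h_pos[OF assms(4,5), of "L / 2"] by auto
  moreover have "gain_bound L c d \<psi> \<upsilon> k" if "\<bar>k\<bar> \<le> sqrt q" for k
    unfolding gain_bound_iff[OF assms(4,1,5)] q_def[symmetric]
    using that \<open>q > 0\<close> by (simp add: sqrt_ge_absD)
  ultimately show ?thesis
    by (intro exI[of _ "sqrt q"]) auto
qed

section \<open>Exponential decay of the closed loop system\<close>

theorem theorem1:
  "\<exists>\<mu> :: real \<Rightarrow> real \<Rightarrow> real \<Rightarrow> real.
   \<forall>(L::real) (\<epsilon>\<^sub>0::real) (M::real) (c::real).
     L > 0 \<and> \<epsilon>\<^sub>0 > 0 \<and> M > 0 \<and> c > 0 \<and> (2 * \<epsilon>\<^sub>0 + 6 * M) * L < c \<longrightarrow>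
     (\<exists>\<psi> \<upsilon>. \<psi> > 0 \<and> \<upsilon> \<in> {(tanh (\<psi> * L))\<^sup>2<..1} \<and> weight_choice L \<epsilon>\<^sub>0 M c \<psi> \<upsilon> \<and> \<mu> c \<psi> \<upsilon> > 0 \<and>
        (\<forall>d\<ge>c. \<exists>\<kappa>>0. \<forall>k\<^sub>0 k\<^sub>L.
           (\<bar>k\<^sub>0\<bar> \<le> \<kappa> \<and> \<bar>k\<^sub>L\<bar> \<le> \<kappa>) \<or> (gain_bound L c d \<psi> \<upsilon> k\<^sub>0 \<and> gain_bound L c d \<psi> \<upsilon> k\<^sub>L) \<longrightarrow>
           (\<forall>T>0. \<forall>lamp lamm Gp Gm \<delta>p \<delta>m.
              C1_on lamp UNIV \<and> C1_on lamm UNIV \<and> continuous_on UNIV Gp \<and> continuous_on UNIV Gm \<and>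
              source_bound M Gp \<and> source_bound M Gm \<and>
              classical_solution T L k\<^sub>0 k\<^sub>L lamp lamm Gp Gm \<delta>p \<delta>m \<and>
              speed_bounds T L \<epsilon>\<^sub>0 c d lamp lamm \<delta>p \<delta>m \<longrightarrow>
              (\<forall>t\<in>{0..T}. lyapunov L \<psi> \<upsilon> \<delta>p \<delta>m t
                 \<le> exp (- \<mu> c \<psi> \<upsilon> * t) * lyapunov L \<psi> \<upsilon> \<delta>p \<delta>m 0)))) \<and>
     (\<forall>\<psi> \<upsilon>. \<psi> > 0 \<and> \<upsilon> \<in> {(tanh (\<psi> * L))\<^sup>2<..1} \<and> weight_choice L \<epsilon>\<^sub>0 M c \<psi> \<upsilon> \<longrightarrow>
        (\<forall>d\<ge>c. \<exists>\<kappa>>0. \<forall>k\<^sub>0 k\<^sub>L.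
           (\<bar>k\<^sub>0\<bar> \<le> \<kappa> \<and> \<bar>k\<^sub>L\<bar> \<le> \<kappa>) \<or> (gain_bound L c d \<psi> \<upsilon> k\<^sub>0 \<and> gain_bound L c d \<psi> \<upsilon> k\<^sub>L) \<longrightarrow>
           (\<forall>T>0. \<forall>lamp lamm Gp Gm \<delta>p \<delta>m.
              C1_on lamp UNIV \<and> C1_on lamm UNIV \<and> continuous_on UNIV Gp \<and> continuous_on UNIV Gm \<and>
              source_bound M Gp \<and> source_bound M Gm \<and>
              classical_solution T L k\<^sub>0 k\<^sub>L lamp lamm Gp Gm \<delta>p \<delta>m \<and>
              speed_bounds T L \<epsilon>\<^sub>0 c d lamp lamm \<delta>p \<delta>m \<longrightarrow>
              (\<forall>t\<in>{0..T}. lyapunov L \<psi> \<upsilon> \<delta>p \<delta>m t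
                 \<le> exp (- (c * \<psi> * sqrt \<upsilon>) * t) * lyapunov L \<psi> \<upsilon> \<delta>p \<delta>m 0))))"
proof -
  have decay: "\<exists>\<kappa>>0. \<forall>k\<^sub>0 k\<^sub>L.
      (\<bar>k\<^sub>0\<bar> \<le> \<kappa> \<and> \<bar>k\<^sub>L\<bar> \<le> \<kappa>) \<or> (gain_bound L c d \<psi> \<upsilon> k\<^sub>0 \<and> gain_bound L c d \<psi> \<upsilon> k\<^sub>L) \<longrightarrow>
      (\<forall>T>0. \<forall>lamp lamm Gp Gm \<delta>p \<delta>m.
         C1_on lamp UNIV \<and> C1_on lamm UNIV \<and> continuous_on UNIV Gp \<and> continuous_on UNIV Gm \<and>
         source_bound M Gp \<and> source_bound M Gm \<and>
         classical_solution T L k\<^sub>0 k\<^sub>L lamp lamm Gp Gm \<delta>p \<delta>m \<and>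
         speed_bounds T L \<epsilon>\<^sub>0 c d lamp lamm \<delta>p \<delta>m \<longrightarrow>
         (\<forall>t\<in>{0..T}. lyapunov L \<psi> \<upsilon> \<delta>p \<delta>m t
            \<le> exp (- (c * \<psi> * sqrt \<upsilon>) * t) * lyapunov L \<psi> \<upsilon> \<delta>p \<delta>m 0))"
    if hyp: "L > 0" "\<epsilon>\<^sub>0 > 0" "M > 0" "c > 0" "\<psi> > 0" "\<upsilon> \<in> {(tanh (\<psi> * L))\<^sup>2<..1}"
      "weight_choice L \<epsilon>\<^sub>0 M c \<psi> \<upsilon>" "d \<ge> c" for L \<epsilon>\<^sub>0 M c \<psi> \<upsilon> d :: real
  proof -
    have \<upsilon>: "(tanh (\<psi> * L))\<^sup>2 < \<upsilon>" "\<upsilon> \<le> 1" using hyp by auto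
    obtain \<kappa> where "\<kappa> > 0" and \<kappa>: "\<And>k. \<bar>k\<bar> \<le> \<kappa> \<Longrightarrow> gain_bound L c d \<psi> \<upsilon> k"
      using small_gains_satisfy_gain_bound[OF hyp(1,4,8,5) \<upsilon>(1)] by blast
    show ?thesis
    proof (intro exI[of _ \<kappa>] conjI \<open>\<kappa> > 0\<close> allI impI ballI, elim conjE)
      fix k\<^sub>0 k\<^sub>L T t :: real and lamp lamm Gp Gm \<delta>p \<delta>m :: "real \<times> real \<Rightarrow> real"
      assume k: "(\<bar>k\<^sub>0\<bar> \<le> \<kappa> \<and> \<bar>k\<^sub>L\<bar> \<le> \<kappa>) \<or> (gain_bound L c d \<psi> \<upsilon> k\<^sub>0 \<and> gain_bound L c d \<psi> \<upsilon> k\<^sub>L)"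
        and T: "T > 0" and t: "t \<in> {0..T}"
        and hyps: "C1_on lamp UNIV" "C1_on lamm UNIV" "source_bound M Gp" "source_bound M Gm"
          "classical_solution T L k\<^sub>0 k\<^sub>L lamp lamm Gp Gm \<delta>p \<delta>m"
          "speed_bounds T L \<epsilon>\<^sub>0 c d lamp lamm \<delta>p \<delta>m"
      have gains: "gain_bound L c d \<psi> \<upsilon> k\<^sub>0" "gain_bound L c d \<psi> \<upsilon> k\<^sub>L"
        using k \<kappa> by auto
      show "lyapunov L \<psi> \<upsilon> \<delta>p \<delta>m t
          \<le> exp (- (c * \<psi> * sqrt \<upsilon>) * t) * lyapunov L \<psi> \<upsilon> \<delta>p \<delta>m 0"
        by (rule lyapunov_decay[OF hyp(1) T hyp(3,2,4,8,5) \<upsilon> hyp(7) gains hyps t])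
    qed
  qed
  show ?thesis
  proof (intro exI[of _ "\<lambda>c \<psi> \<upsilon>. c * \<psi> * sqrt \<upsilon>"] allI impI, elim conjE, intro conjI, goal_cases)
    case (1 L \<epsilon>\<^sub>0 M c)
    then obtain \<psi> \<upsilon> where w: "\<psi> > 0" "\<upsilon> \<in> {(tanh (\<psi> * L))\<^sup>2<..1}" "weight_choice L \<epsilon>\<^sub>0 M c \<psi> \<upsilon>"
      using weight_choice_exists by blast
    have "\<upsilon> > 0"
      using w(2) le_less_trans[OF zero_le_power2, of "tanh (\<psi> * L)" \<upsilon>] by simp
    then have rate: "c * \<psi> * sqrt \<upsilon> > 0"
      using 1 w by simp
    show ?case
      by (rule exI[of _ \<psi>], rule exI[of _ \<upsilon>])
        (intro conjI w rate allI impI decay[OF 1(1-4) w])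
  next
    case (2 L \<epsilon>\<^sub>0 M c)
    show ?case
      by (intro allI impI, elim conjE, rule decay[OF 2(1-4)])
  qed
qed

end
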